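(* Let $r\in\mathbb{N}$, let $f\colon\mathbb{N}\to\mathbb{C}$ be an arithmetic function and let $f'=\mu*f$. Then the following assertions are equivalent: i) $f$ is $r$-even; ii) $f(n)=\sum_{d\mid \gcd(n,r)} f'(d)$ for every $n\in\mathbb{N}$; iii) $f'(n)=0$ for every $n\in\mathbb{N}$ with $n\nmid r$.
   Context: $\mathbb{N}=\{1,2,\ldots\}$. The Dirichlet convolution of $f,g\colon\mathbb{N}\to\mathbb{C}$ is $(f*g)(n)=\sum_{d\mid n}f(d)g(n/d)$; $\mu$ is the Möbius function. For fixed $r\in\mathbb{N}$, a function $f\colon\mathbb{N}\to\mathbb{C}$ is called $r$-even if $f(\gcd(n,r))=f(n)$ for all $n\in\mathbb{N}$. *)

theory Defs
  imports Complex_Main "HOL-Computational_Algebra.Squarefree"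
begin

text \<open>
  Arithmetic functions, whose domain is the positive integers, are represented as functions on
  \<^typ>\<open>nat\<close>; their value at \<open>0\<close> is irrelevant.
\<close>

definition moebius_mu :: "nat \<Rightarrow> complex" where
  "moebius_mu n = (if squarefree n then (-1) ^ card (prime_factors n) else 0)"

definition dirichlet_conv :: "(nat \<Rightarrow> complex) \<Rightarrow> (nat \<Rightarrow> complex) \<Rightarrow> nat \<Rightarrow> complex" where
  "dirichlet_conv f g n = (\<Sum>d | d dvd n. f d * g (n div d))"

definition r_even :: "nat \<Rightarrow> (nat \<Rightarrow> complex) \<Rightarrow> bool" where
  "r_even r f \<longleftrightarrow> (\<forall>n>0. f (gcd n r) = f n)"

end

theory Submission
  imports Defs
begin

text \<open>
  Everything rests on the fact that \<open>f\<close> and \<open>f' = \<mu> * f\<close> determine each other through summation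
  over divisors. On the one hand Moebius inversion gives \<open>f n = (\<Sum>d | d dvd n. f' d)\<close> for
  \<open>n > 0\<close>; this comes down to \<open>(\<Sum>d | d dvd n. \<mu> d)\<close> vanishing for \<open>n > 1\<close>, which is proved by
  pairing each squarefree divisor free of a chosen prime with its multiple by that prime. On the
  other hand a function on the positive integers is determined by its divisor sums.

  If \<open>f\<close> is \<open>r\<close>-even, inversion at \<open>gcd n r\<close> yields the formula in (ii); conversely the right-hand
  side of (ii) depends on \<open>n\<close> only through \<open>gcd n r\<close>. The sum in (ii) is also the divisor sum at
  \<open>n\<close> of the function that agrees with \<open>f'\<close> on the divisors of \<open>r\<close> and is \<open>0\<close> elsewhere. Hence
  (ii) says that this function and \<open>f'\<close> have the same divisor sums, that is, that they
  agree on the positive integers, which is (iii).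
\<close>

lemma moebius_mu_prime_mult:
  assumes "prime p" "\<not> p dvd d"
  shows "moebius_mu (p * d) = - moebius_mu d"
proof -
  have cop: "coprime p d" using assms by (simp add: prime_imp_coprime)
  have d0: "d \<noteq> 0" using assms(2) by (metis dvd_0_right)
  have sq: "squarefree (p * d) \<longleftrightarrow> squarefree d"
    using squarefree_mult_coprime[OF cop] squarefree_prime[of p] assms(1)
    by (auto dest: squarefree_multD)
  have "prime_factors (p * d) = insert p (prime_factors d)"
    using assms(1) d0 by (subst prime_factors_product) (auto simp: prime_prime_factors)
  moreover have "p \<notin> prime_factors d" using assms(2) by auto
  ultimately have "card (prime_factors (p * d)) = Suc (card (prime_factors d))" by simp
  then show ?thesis by (simp add: moebius_mu_def sq)
qed

text \<open>
  For \<open>n > 1\<close> fix a prime \<open>p\<close> dividing \<open>n\<close>. Inserting or removing the factor \<open>p\<close> is an involution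
  on the squarefree divisors of \<open>n\<close> that flips the sign of \<open>\<mu>\<close>, so the sum equals its own negative.
\<close>

lemma sum_moebius_mu_divisors:
  assumes "n > 0"
  shows "(\<Sum>d | d dvd n. moebius_mu d) = (if n = 1 then 1 else 0)"
proof (cases "n = 1")
  case True
  then show ?thesis by (simp add: moebius_mu_def)
next
  case False
  then obtain p where p: "prime p" "p dvd n"
    using prime_factor_nat by blast
  then have p0: "p > 0" by (simp add: prime_gt_0_nat)
  define S where "S = {d. d dvd n \<and> squarefree d}"
  define i where "i = (\<lambda>d. if p dvd d then d div p else p * d)"
  have i: "i d \<in> S \<and> i (i d) = d \<and> moebius_mu (i d) = - moebius_mu d" if "d \<in> S" for d
  proof (cases "p dvd d")
    case True
    then obtain e where e: "d = p * e" by blast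
    have sq: "squarefree (p * e)" using that by (simp add: S_def e)
    have ne: "\<not> p dvd e"
    proof
      assume "p dvd e"
      then have "p\<^sup>2 dvd p * e" by (simp add: power2_eq_square)
      then show False using squarefreeD[OF sq] p(1) by (metis not_prime_unit)
    qed
    have i_d: "i d = e" using p0 by (simp add: i_def e)
    have "e \<in> S" using that sq by (auto simp: S_def e dest: squarefree_multD dvd_mult_right)
    moreover have "i e = d" using ne by (simp add: i_def e)
    ultimately show ?thesis
      unfolding i_d using moebius_mu_prime_mult[OF p(1) ne] by (simp add: e)
  next
    case ne: False
    have cop: "coprime p d" using p(1) ne by (simp add: prime_imp_coprime)
    have "p * d dvd n" using that p(2) cop by (simp add: S_def divides_mult)
    moreover have "squarefree (p * d)"
      using squarefree_mult_coprime[OF cop] squarefree_prime[of p] p(1) that by (simp add: S_def)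
    ultimately show ?thesis
      using moebius_mu_prime_mult[OF p(1) ne] ne p0 by (simp add: S_def i_def)
  qed
  have "(\<Sum>d\<in>S. moebius_mu d) = (\<Sum>d\<in>S. - moebius_mu d)"
    by (rule sum.reindex_bij_witness[of _ i i]) (use i in auto)
  then have "(\<Sum>d\<in>S. moebius_mu d) = 0" by (simp add: sum_negf)
  moreover have "(\<Sum>d | d dvd n. moebius_mu d) = (\<Sum>d\<in>S. moebius_mu d)"
    by (rule sum.mono_neutral_right)
      (use assms in \<open>auto simp: S_def moebius_mu_def finite_divisors_nat\<close>)
  ultimately show ?thesis using False by simp
qed

text \<open>
  Substituting \<open>d = k * e\<close> turns the double sum over \<open>e dvd d dvd n\<close> into one over
  \<open>k dvd n\<close> and \<open>e dvd n div k\<close>, whose inner Moebius sum survives only for \<open>k = n\<close>.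
\<close>

lemma moebius_inversion:
  assumes "n > 0"
  shows "(\<Sum>d | d dvd n. dirichlet_conv moebius_mu f d) = f n"
proof -
  have pos: "d > 0" if "d dvd n" for d using that assms by (rule dvd_pos_nat[rotated])
  have fin: "finite {e. e dvd d}" if "d dvd n" for d
    using pos[OF that] by (rule finite_divisors_nat)
  have quot: "n div k > 0" if "k dvd n" for k
    using that assms by (metis dvd_div_eq_0_iff gr0I less_numeral_extra(3))
  have "(\<Sum>d | d dvd n. dirichlet_conv moebius_mu f d)
      = (\<Sum>(d, e)\<in>(SIGMA d:{d. d dvd n}. {e. e dvd d}). moebius_mu e * f (d div e))"
    unfolding dirichlet_conv_def
    by (rule sum.Sigma) (use fin assms in auto)
  also have "\<dots> = (\<Sum>(k, e)\<in>(SIGMA k:{k. k dvd n}. {e. e dvd n div k}). moebius_mu e * f k)"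
    by (rule sum.reindex_bij_witness[of _ "\<lambda>(k, e). (k * e, e)" "\<lambda>(d, e). (d div e, e)"])
      (use assms in \<open>auto elim!: dvdE\<close>)
  also have "\<dots> = (\<Sum>k | k dvd n. \<Sum>e | e dvd n div k. moebius_mu e * f k)"
    by (rule sum.Sigma[symmetric]) (use quot fin assms in \<open>auto simp: finite_divisors_nat\<close>)
  also have "\<dots> = (\<Sum>k | k dvd n. if k = n then f k else 0)"
  proof (rule sum.cong[OF refl])
    fix k assume "k \<in> {k. k dvd n}"
    then have k: "k dvd n" by simp
    have "(\<Sum>e | e dvd n div k. moebius_mu e * f k) = (if n div k = 1 then 1 else 0) * f k"
      using sum_moebius_mu_divisors[OF quot[OF k]] by (simp flip: sum_distrib_right)
    moreover have "n div k = 1 \<longleftrightarrow> k = n" using k assms by (auto elim!: dvdE)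
    ultimately show "(\<Sum>e | e dvd n div k. moebius_mu e * f k) = (if k = n then f k else 0)"
      by simp
  qed
  also have "\<dots> = f n" using fin[of n] by simp
  finally show ?thesis .
qed

text \<open>
  The divisor sum at \<open>n\<close> is the value at \<open>n\<close> plus the values at the smaller divisors, which agree
  by induction and cancel.
\<close>

lemma divisor_sums_determine:
  fixes g h :: "nat \<Rightarrow> 'a::cancel_comm_monoid_add"
  assumes "\<And>n. n > 0 \<Longrightarrow> (\<Sum>d | d dvd n. g d) = (\<Sum>d | d dvd n. h d)"
    and "n > 0"
  shows "g n = h n"
  using assms(2)
proof (induction n rule: less_induct)
  case (less n)
  let ?D = "{d. d dvd n} - {n}"
  have fin: "finite {d. d dvd n}" using less.prems by (rule finite_divisors_nat)
  have "(\<Sum>d\<in>?D. g d) = (\<Sum>d\<in>?D. h d)"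
  proof (rule sum.cong[OF refl])
    fix d assume "d \<in> ?D"
    then have "d < n" "d > 0" using less.prems
      by (auto simp: dvd_pos_nat intro: le_neq_implies_less dvd_imp_le)
    then show "g d = h d" by (rule less.IH)
  qed
  then show ?case
    using assms(1)[OF less.prems] fin by (simp add: sum.remove[of _ n])
qed

lemma sum_divisors_gcd:
  fixes g :: "nat \<Rightarrow> 'a::comm_monoid_add"
  assumes "n > 0"
  shows "(\<Sum>d | d dvd gcd n r. g d) = (\<Sum>d | d dvd n. if d dvd r then g d else 0)"
proof -
  have "{d. d dvd gcd n r} = {d \<in> {d. d dvd n}. d dvd r}" by auto
  then show ?thesis
    using sum.inter_filter[OF finite_divisors_nat[OF assms], of g "\<lambda>d. d dvd r"] by simp
qed

theorem proposition1:
  fixes r :: nat and f f' :: "nat \<Rightarrow> complex"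
  assumes "r > 0"
    and "f' = dirichlet_conv moebius_mu f"
  shows "(r_even r f \<longleftrightarrow> (\<forall>n>0. f n = (\<Sum>d | d dvd gcd n r. f' d))) \<and>
         ((\<forall>n>0. f n = (\<Sum>d | d dvd gcd n r. f' d)) \<longleftrightarrow> (\<forall>n>0. \<not> n dvd r \<longrightarrow> f' n = 0))"
proof -
  have inv: "(\<Sum>d | d dvd n. f' d) = f n" if "n > 0" for n
    unfolding assms(2) using that by (rule moebius_inversion)
  let ?h = "\<lambda>d. if d dvd r then f' d else 0"
  have "r_even r f \<longleftrightarrow> (\<forall>n>0. f n = (\<Sum>d | d dvd gcd n r. f' d))"
    unfolding r_even_def
  proof
    assume even: "\<forall>n>0. f (gcd n r) = f n"
    show "\<forall>n>0. f n = (\<Sum>d | d dvd gcd n r. f' d)"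
    proof (intro allI impI)
      fix n :: nat assume "n > 0"
      then have "f n = f (gcd n r)" "gcd n r > 0" using even by simp_all
      then show "f n = (\<Sum>d | d dvd gcd n r. f' d)" using inv by metis
    qed
  next
    assume "\<forall>n>0. f n = (\<Sum>d | d dvd gcd n r. f' d)"
    then show "\<forall>n>0. f (gcd n r) = f n" by simp
  qed
  moreover have "(\<forall>n>0. f n = (\<Sum>d | d dvd gcd n r. f' d)) \<longleftrightarrow>
      (\<forall>n>0. (\<Sum>d | d dvd n. f' d) = (\<Sum>d | d dvd n. ?h d))"
    using inv sum_divisors_gcd[where g = f' and r = r] by simp
  moreover have "\<dots> \<longleftrightarrow> (\<forall>n>0. f' n = ?h n)"
  proof
    assume "\<forall>n>0. (\<Sum>d | d dvd n. f' d) = (\<Sum>d | d dvd n. ?h d)"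
    then show "\<forall>n>0. f' n = ?h n"
      using divisor_sums_determine[of f' ?h] by blast
  next
    assume eq: "\<forall>n>0. f' n = ?h n"
    have "(\<Sum>d | d dvd n. f' d) = (\<Sum>d | d dvd n. ?h d)" if "n > 0" for n
    proof (rule sum.cong[OF refl])
      fix d assume "d \<in> {d. d dvd n}"
      then have "d > 0" using that by (simp add: dvd_pos_nat)
      then show "f' d = ?h d" using eq by blast
    qed
    then show "\<forall>n>0. (\<Sum>d | d dvd n. f' d) = (\<Sum>d | d dvd n. ?h d)" by blast
  qed
  moreover have "\<dots> \<longleftrightarrow> (\<forall>n>0. \<not> n dvd r \<longrightarrow> f' n = 0)" by auto
  ultimately show ?thesis by blast
qed

end
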